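(* Let $n=2^\ell$ with $\ell\ge 1$ an integer, and consider a knockout tournament with $n$ players of equal strength (i.e. $p_{ij}=1/2$ for all $i\ne j$) and with a random draw. Let $S_i$ be the number of games won by player $i\in\{1,\dots,n\}$. Then the random vector $\boldsymbol S=(S_1,\dots,S_n)$ is negatively regression dependent (NRD), negatively left-tail dependent (NLTD) and negatively right-tail dependent (NRTD).
   Context: Notation: $[n]=\{1,\dots,n\}$; for $J\subset[n]$, $\boldsymbol X_J=(X_j)_{j\in J}$, and inequalities between vectors (such as $\boldsymbol X_J\le \boldsymbol x_J$, $\boldsymbol X_J>\boldsymbol x_J$) are componentwise. "Increasing" and "decreasing" are in the weak sense. $[\boldsymbol X\mid A]$ denotes any random vector whose distribution is the conditional distribution of $\boldsymbol X$ given the event $A$; whenever it is written, it is assumed that $\mathbb P(A)>0$. Usual stochastic order: $\boldsymbol X\le_{\rm st}\boldsymbol Y$ if $\mathbb E[\varphi(\boldsymbol X)]\le\mathbb E[\varphi(\boldsymbol Y)]$ for all (coordinatewise) increasing real functions $\varphi$ for which the expectations exist. A random vector $\boldsymbol X=(X_1,\dots,X_n)$ is - NRD if $[\boldsymbol X_I\mid \boldsymbol X_J=\boldsymbol x_J]\ge_{\rm st}[\boldsymbol X_I\mid \boldsymbol X_J=\boldsymbol x_J^*]$, - NLTD if $[\boldsymbol X_I\mid \boldsymbol X_J\le\boldsymbol x_J]\ge_{\rm st}[\boldsymbol X_I\mid \boldsymbol X_J\le\boldsymbol x_J^*]$, - NRTD if $[\boldsymbol X_I\mid \boldsymbol X_J>\boldsymbol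 x_J]\ge_{\rm st}[\boldsymbol X_I\mid \boldsymbol X_J>\boldsymbol x_J^*]$, in each case for all disjoint subsets $I,J\subset[n]$ and all $\boldsymbol x_J\le\boldsymbol x_J^*$ (for which the conditioning events have positive probability). Knockout tournament with $n=2^\ell$ players: whenever players $i\neq j$ meet, player $i$ defeats player $j$ with probability $p_{ij}$ (and $p_{ji}=1-p_{ij}$), independently of all other duels. The winners of one round move to the next round and the defeated players are eliminated; the tournament continues until only one player remains. Random draw: in the first round all $2^\ell$ players are randomly (uniformly) arranged into $2^{\ell-1}$ match pairs; the $2^{\ell-1}$ winners move to the second round and are randomly (uniformly) arranged into $2^{\ell-2}$ match pairs, and so on, the arrangements being independent of the outcomes of the duels. *)

theory Defs
  imports "HOL-Probability.Probability"
begin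

section \<open>Usual stochastic order and negative dependence\<close>

text \<open>A random vector is a family \<open>X\<close> of real random variables, of which the components in
  \<open>{1..n}\<close> matter. The subvector \<open>X\<^sub>I\<close> is the extensional function on \<open>I\<close>, so that the
  pointwise order on \<open>I \<rightarrow>\<^sub>E UNIV\<close> is exactly the componentwise order on \<open>I\<close>.\<close>

definition subvec :: "(nat \<Rightarrow> 'a \<Rightarrow> real) \<Rightarrow> nat set \<Rightarrow> 'a \<Rightarrow> (nat \<Rightarrow> real)" where
  "subvec X I \<omega> = (\<lambda>i\<in>I. X i \<omega>)"

text \<open>The order \<open>X\<^sub>I \<le>\<^sub>s\<^sub>t Y\<^sub>I\<close>, with \<open>X\<close> and \<open>Y\<close> possibly living on different spaces.
  Existence of the two expectations is integrability.\<close>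

definition st_le ::
  "nat set \<Rightarrow> 'a measure \<Rightarrow> (nat \<Rightarrow> 'a \<Rightarrow> real) \<Rightarrow> 'b measure \<Rightarrow> (nat \<Rightarrow> 'b \<Rightarrow> real) \<Rightarrow> bool" where
  "st_le I M X N Y \<longleftrightarrow>
    (\<forall>\<phi> :: (nat \<Rightarrow> real) \<Rightarrow> real.
      mono_on (I \<rightarrow>\<^sub>E UNIV) \<phi> \<longrightarrow>
      integrable M (\<lambda>\<omega>. \<phi> (subvec X I \<omega>)) \<longrightarrow>
      integrable N (\<lambda>\<omega>. \<phi> (subvec Y I \<omega>)) \<longrightarrow>
      (\<integral>\<omega>. \<phi> (subvec X I \<omega>) \<partial>M) \<le> (\<integral>\<omega>. \<phi> (subvec Y I \<omega>) \<partial>N))"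

definition cond_event ::
  "(real \<Rightarrow> real \<Rightarrow> bool) \<Rightarrow> 'a measure \<Rightarrow> (nat \<Rightarrow> 'a \<Rightarrow> real) \<Rightarrow> nat set \<Rightarrow> (nat \<Rightarrow> real) \<Rightarrow> 'a set" where
  "cond_event R M X J x = {\<omega> \<in> space M. \<forall>j\<in>J. R (X j \<omega>) (x j)}"

text \<open>The common shape of the three notions; \<open>R\<close> is the relation in the conditioning event
  \<open>R X\<^sub>J x\<^sub>J\<close>, taken componentwise. Under \<open>uniform_measure M A\<close> the random vector \<open>X\<close> has the
  conditional distribution of \<open>X\<close> given \<open>A\<close>.\<close>

definition neg_dependent ::
  "(real \<Rightarrow> real \<Rightarrow> bool) \<Rightarrow> nat \<Rightarrow> 'a measure \<Rightarrow> (nat \<Rightarrow> 'a \<Rightarrow> real) \<Rightarrow> bool" where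
  "neg_dependent R n M X \<longleftrightarrow>
    (\<forall>I J x x'.
      I \<subseteq> {1..n} \<longrightarrow> J \<subseteq> {1..n} \<longrightarrow> I \<inter> J = {} \<longrightarrow>
      (\<forall>j\<in>J. x j \<le> x' j) \<longrightarrow>
      measure M (cond_event R M X J x) > 0 \<longrightarrow>
      measure M (cond_event R M X J x') > 0 \<longrightarrow>
      st_le I (uniform_measure M (cond_event R M X J x')) X
              (uniform_measure M (cond_event R M X J x)) X)"

definition NRD :: "nat \<Rightarrow> 'a measure \<Rightarrow> (nat \<Rightarrow> 'a \<Rightarrow> real) \<Rightarrow> bool" where
  "NRD = neg_dependent (=)"

definition NLTD :: "nat \<Rightarrow> 'a measure \<Rightarrow> (nat \<Rightarrow> 'a \<Rightarrow> real) \<Rightarrow> bool" where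
  "NLTD = neg_dependent (\<le>)"

definition NRTD :: "nat \<Rightarrow> 'a measure \<Rightarrow> (nat \<Rightarrow> 'a \<Rightarrow> real) \<Rightarrow> bool" where
  "NRTD = neg_dependent (>)"


section \<open>Knockout tournaments with a random draw\<close>

definition pairings :: "nat set \<Rightarrow> nat set set set" where
  "pairings A = {M. partition_on A M \<and> (\<forall>e\<in>M. card e = 2)}"

text \<open>The winner of the match \<open>e = {i, j}\<close>. Naming the two players through \<open>Min\<close> and \<open>Max\<close>
  is harmless because \<open>p j i = 1 - p i j\<close>.\<close>

definition duel :: "(nat \<Rightarrow> nat \<Rightarrow> real) \<Rightarrow> nat set \<Rightarrow> nat pmf" where
  "duel p e = map_pmf (\<lambda>b. if b then Min e else Max e) (bernoulli_pmf (p (Min e) (Max e)))"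

text \<open>A round is recorded as its set of matches together with the map sending each match to
  its winner; the value of this map off the set of matches is an irrelevant default.\<close>

type_synonym round = "nat set set \<times> (nat set \<Rightarrow> nat)"

definition play_round :: "(nat \<Rightarrow> nat \<Rightarrow> real) \<Rightarrow> nat set \<Rightarrow> round pmf" where
  "play_round p A = do {
     M \<leftarrow> pmf_of_set (pairings A);
     w \<leftarrow> Pi_pmf M 0 (duel p);
     return_pmf (M, w)
   }"

definition winners :: "round \<Rightarrow> nat set" where
  "winners r = snd r ` fst r"

text \<open>The first argument after \<open>p\<close> is the number of rounds: starting from \<open>2 ^ k\<close> players,
  exactly one player remains after \<open>k\<close> rounds.\<close>

primrec knockout :: "(nat \<Rightarrow> nat \<Rightarrow> real) \<Rightarrow> nat \<Rightarrow> nat set \<Rightarrow> round list pmf" where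
  "knockout p 0 A = return_pmf []"
| "knockout p (Suc k) A = do {
     r \<leftarrow> play_round p A;
     rs \<leftarrow> knockout p k (winners r);
     return_pmf (r # rs)
   }"

definition tournament :: "(nat \<Rightarrow> nat \<Rightarrow> real) \<Rightarrow> nat \<Rightarrow> round list pmf" where
  "tournament p l = knockout p l {1..2 ^ l}"

definition games_won :: "nat \<Rightarrow> round list \<Rightarrow> nat" where
  "games_won i rs = (\<Sum>(M, w)\<leftarrow>rs. card {e \<in> M. w e = i})"

end

theory Submission imports Defs begin

text \<open>
  The number of players that win exactly \<open>k\<close> games is not random: half of the players of each round
  drop out. So the multiset of the scores is fixed (\<open>score_law_support\<close>). Since all players are equally
  strong and the draw is uniform, renaming the players does not change the law of the tournament
  (\<open>score_law_equivariant\<close>). Hence the score vector \<open>X\<close> is \<open>a \<circ> \<sigma>\<close> for a fixed increasing sequence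
  \<open>a\<close> of scores and a uniformly random arrangement \<open>\<sigma>\<close> (\<open>expectation_score_law\<close>), and all three kinds of negative
  dependence hold for every such arrangement. They are proved as inequalities between sums over
  arrangements \<open>\<sigma>\<close>, by induction over the conditioned coordinates \<open>J\<close>: once the rank \<open>s = \<sigma> j\<close> of one
  coordinate is fixed, the others form a uniform arrangement of the sequence \<open>a\<close> with its entry at
  \<open>s\<close> deleted (\<open>arr_sum_insert\<close>).

  For regression dependence, conditioning \<open>X j\<close> on a smaller value deletes a smaller entry, and what
  is left over for the other coordinates is larger, entry by entry (\<open>skip_level_le\<close>). This holds for
  every choice of the two ranks compatible with the two values, so the inequality can be summed
  over all pairs of ranks (\<open>arr_sum_level_sets\<close>).

  For the left tail, the event \<open>X j \<le> x j\<close> says that \<open>\<sigma> j\<close> lies below a bound. Raising the bound of one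
  coordinate \<open>j\<close> adds larger ranks for \<open>j\<close>. A larger rank of \<open>j\<close> leaves smaller entries to the other
  coordinates and, relative to the remaining ranks, weaker bounds on those in \<open>J\<close>; both effects
  lower the conditional mean of an increasing function of the coordinates in \<open>I\<close>
  (\<open>arr_sum_lower_sets\<close>). Reversing the order gives the right tail (\<open>arr_sum_up_sets\<close>).
\<close>

section \<open>Sums over arrangements\<close>

text \<open>The increasing enumeration of \<open>\<nat> - {s}\<close>: composing a sequence with \<open>skip s\<close> deletes its
  entry at \<open>s\<close> and closes the gap.\<close>

definition skip :: "nat \<Rightarrow> nat \<Rightarrow> nat" where
  "skip s i = (if i < s then i else Suc i)"

text \<open>The ways to hand out the ranks \<open>0, \<dots>, n - 1\<close> to the members of \<open>K\<close>, each rank once. Being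
  extensional, an arrangement is determined by its values on \<open>K\<close>.\<close>

definition arrangements :: "'i set \<Rightarrow> nat \<Rightarrow> ('i \<Rightarrow> nat) set" where
  "arrangements K n = {\<sigma> \<in> extensional K. bij_betw \<sigma> K {..<n}}"

text \<open>Let \<open>K\<close> have \<open>n\<close> members. If the ranks \<open>0, \<dots>, n - 1\<close> carry the values \<open>a 0, \<dots>, a (n - 1)\<close> and \<open>\<sigma>\<close> is
  a uniform arrangement, then \<open>a \<circ> \<sigma>\<close> is a random vector. Up to the common factor \<open>1 / n!\<close>, \<open>arr_sum \<phi> a K n J B\<close> is the
  expectation of \<open>\<phi> (a \<circ> \<sigma>)\<close> on the event that \<open>\<sigma> j \<in> B j\<close> for all \<open>j \<in> J\<close>, and \<open>arr_count K n J B\<close>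
  is the probability of that event; their quotient is the conditional expectation.\<close>

definition arr_sum ::
  "(('i \<Rightarrow> real) \<Rightarrow> real) \<Rightarrow> (nat \<Rightarrow> real) \<Rightarrow> 'i set \<Rightarrow> nat \<Rightarrow> 'i set \<Rightarrow> ('i \<Rightarrow> nat set) \<Rightarrow> real" where
  "arr_sum \<phi> a K n J B = (\<Sum>\<sigma> | \<sigma> \<in> arrangements K n \<and> (\<forall>j\<in>J. \<sigma> j \<in> B j). \<phi> (\<lambda>i. a (\<sigma> i)))"

definition arr_count :: "'i set \<Rightarrow> nat \<Rightarrow> 'i set \<Rightarrow> ('i \<Rightarrow> nat set) \<Rightarrow> real" where
  "arr_count K n J B = real (card {\<sigma> \<in> arrangements K n. \<forall>j\<in>J. \<sigma> j \<in> B j})"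

text \<open>Monotonicity in the coordinates \<open>I\<close> alone; in particular \<open>\<phi> u\<close> depends only on the restriction
  of \<open>u\<close> to \<open>I\<close>.\<close>

definition increasing_in :: "'i set \<Rightarrow> (('i \<Rightarrow> real) \<Rightarrow> real) \<Rightarrow> bool" where
  "increasing_in I \<phi> \<longleftrightarrow> (\<forall>u v. (\<forall>i\<in>I. u i \<le> v i) \<longrightarrow> \<phi> u \<le> \<phi> v)"

lemma increasing_in_cong:
  assumes "increasing_in I \<phi>" "\<And>i. i \<in> I \<Longrightarrow> u i = v i"
  shows "\<phi> u = \<phi> v"
  using assms unfolding increasing_in_def by (metis order.antisym order.refl)

lemma finite_arrangements:
  assumes "finite K"
  shows "finite (arrangements K n)"
proof -
  have "arrangements K n \<subseteq> K \<rightarrow>\<^sub>E {..<n}"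
    by (auto simp: arrangements_def PiE_def bij_betw_def)
  then show ?thesis
    using finite_PiE[OF assms, of "\<lambda>_. {..<n}"] finite_subset by auto
qed

lemma arr_count_conv_arr_sum: "arr_count K n J B = arr_sum (\<lambda>_. 1) a K n J B"
  by (simp add: arr_count_def arr_sum_def)

lemma arr_sum_cong:
  assumes "\<And>j. j \<in> J \<Longrightarrow> B j = B' j"
  shows "arr_sum \<phi> a K n J B = arr_sum \<phi> a K n J B'"
proof -
  have "(\<forall>j\<in>J. \<sigma> j \<in> B j) \<longleftrightarrow> (\<forall>j\<in>J. \<sigma> j \<in> B' j)" for \<sigma> :: "'a \<Rightarrow> nat" using assms by auto
  then show ?thesis unfolding arr_sum_def by simp
qed

lemma arr_count_cong:
  assumes "\<And>j. j \<in> J \<Longrightarrow> B j = B' j"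
  shows "arr_count K n J B = arr_count K n J B'"
  unfolding arr_count_conv_arr_sum[of _ _ _ _ "\<lambda>_. 0"] using assms by (rule arr_sum_cong)

lemma arr_sum_mono:
  assumes "increasing_in I \<phi>" "\<And>i. b i \<le> a i"
  shows "arr_sum \<phi> b K n J B \<le> arr_sum \<phi> a K n J B"
  unfolding arr_sum_def using assms by (intro sum_mono) (auto simp: increasing_in_def)

lemma arr_count_nonneg: "0 \<le> arr_count K n J B"
  by (simp add: arr_count_def)

lemma arr_count_mono:
  assumes "finite K" "\<And>j. j \<in> J \<Longrightarrow> B j \<subseteq> B' j"
  shows "arr_count K n J B \<le> arr_count K n J B'"
  unfolding arr_count_def using assms finite_arrangements[OF assms(1), of n]
  by (auto intro!: card_mono)

lemma arr_sum_eq_0: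
  assumes "finite K" "arr_count K n J B = 0"
  shows "arr_sum \<phi> a K n J B = 0"
proof -
  have "{\<sigma> \<in> arrangements K n. \<forall>j\<in>J. \<sigma> j \<in> B j} = {}"
    using assms finite_arrangements[OF assms(1), of n] by (simp add: arr_count_def)
  then show ?thesis by (simp only: arr_sum_def sum.empty)
qed

text \<open>An arrangement of \<open>insert j K\<close> amounts to the rank \<open>s\<close> of \<open>j\<close> and an arrangement of \<open>K\<close> on the
  remaining ranks, relabelled in increasing order.\<close>

lemma sum_arrangements_insert:
  assumes "j \<notin> K"
  shows "(\<Sum>\<sigma>\<in>arrangements (insert j K) (Suc n). h \<sigma>) =
    (\<Sum>s<Suc n. \<Sum>\<sigma>\<in>arrangements K n. h (\<lambda>i\<in>insert j K. if i = j then s else skip s (\<sigma> i)))"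
proof -
  define ins where "ins = (\<lambda>(s, \<sigma>). \<lambda>i\<in>insert j K. if i = j then s else skip s (\<sigma> i))"
  define del where "del = (\<lambda>\<sigma> :: 'a \<Rightarrow> nat. (\<sigma> j, \<lambda>i\<in>K. if \<sigma> i < \<sigma> j then \<sigma> i else \<sigma> i - 1))"
  have skip_bij: "bij_betw (skip s) {..<n} ({..<Suc n} - {s})" if "s < Suc n" for s
    by (rule bij_betwI[where g = "\<lambda>i. if i < s then i else i - 1"])
       (use that in \<open>auto simp: skip_def split: if_splits\<close>)
  have unskip_bij: "bij_betw (\<lambda>i. if i < s then i else i - 1) ({..<Suc n} - {s}) {..<n}"
    if "s < Suc n" for s
    by (rule bij_betwI[where g = "skip s"], use that in \<open>auto simp: skip_def\<close>, presburger?)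
  have "(\<Sum>\<sigma>\<in>arrangements (insert j K) (Suc n). h \<sigma>) =
        (\<Sum>q\<in>{..<Suc n} \<times> arrangements K n. h (ins q))"
  proof (rule sum.reindex_bij_witness[where i = ins and j = del])
    fix \<sigma> assume s: "\<sigma> \<in> arrangements (insert j K) (Suc n)"
    then have b: "bij_betw \<sigma> (insert j K) {..<Suc n}" and e: "\<sigma> \<in> extensional (insert j K)"
      by (auto simp: arrangements_def)
    have sj: "\<sigma> j < Suc n" using b by (auto simp: bij_betw_def)
    have bK: "bij_betw \<sigma> K ({..<Suc n} - {\<sigma> j})"
    proof -
      have "inj_on \<sigma> (insert j K)" "\<sigma> ` insert j K = {..<Suc n}" using b by (auto simp: bij_betw_def)
      then show ?thesis using assms by (auto simp: bij_betw_def inj_on_def)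
    qed
    have "\<sigma> i \<noteq> \<sigma> j" if "i \<in> K" for i
      using bK that by (auto simp: bij_betw_def)
    then show "ins (del \<sigma>) = \<sigma>"
      using e by (force simp: ins_def del_def skip_def extensional_def)
    show "del \<sigma> \<in> {..<Suc n} \<times> arrangements K n"
      using sj bij_betw_trans[OF bK unskip_bij[OF sj]]
      by (simp add: del_def arrangements_def comp_def cong: bij_betw_cong)
    show "h (ins (del \<sigma>)) = h \<sigma>" by (simp add: \<open>ins (del \<sigma>) = \<sigma>\<close>)
  next
    fix q assume q: "q \<in> {..<Suc n} \<times> arrangements K n"
    obtain s \<sigma> where q': "q = (s, \<sigma>)" by force
    have s: "s < Suc n" and e: "\<sigma> \<in> extensional K" and b: "bij_betw \<sigma> K {..<n}"
      using q q' by (auto simp: arrangements_def)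
    show "del (ins q) = q"
      using e assms unfolding q' ins_def del_def
      by (auto simp: skip_def extensional_def fun_eq_iff)
    have "bij_betw (ins q) K ({..<Suc n} - {s})"
      using bij_betw_trans[OF b skip_bij[OF s]] assms
      by (subst bij_betw_cong[where g = "skip s \<circ> \<sigma>"]) (auto simp: ins_def q')
    moreover have "ins q j = s" by (simp add: ins_def q')
    ultimately have "bij_betw (ins q) (insert j K) (insert s ({..<Suc n} - {s}))"
      using assms notIn_Un_bij_betw[of j K "ins q" "{..<Suc n} - {s}"] by simp
    moreover have "insert s ({..<Suc n} - {s}) = {..<Suc n}" using s by auto
    ultimately show "ins q \<in> arrangements (insert j K) (Suc n)"
      by (auto simp: arrangements_def ins_def q')
  qed
  also have "\<dots> = (\<Sum>s<Suc n. \<Sum>\<sigma>\<in>arrangements K n. h (ins (s, \<sigma>)))"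
    by (simp add: sum.cartesian_product)
  finally show ?thesis by (simp add: ins_def)
qed

text \<open>Conditioning on the rank \<open>s\<close> of \<open>j\<close> leaves a problem of the same shape for the members of \<open>K\<close>,
  with the value of rank \<open>s\<close> deleted.\<close>

lemma arr_sum_insert:
  assumes K: "finite K" "j \<notin> K" "J \<subseteq> K" "I \<subseteq> K" and \<phi>: "increasing_in I \<phi>"
  shows "arr_sum \<phi> a (insert j K) (Suc n) (insert j J) B =
    (\<Sum>s\<in>B j \<inter> {..<Suc n}. arr_sum \<phi> (a \<circ> skip s) K n J (\<lambda>i. skip s -` B i))"
proof -
  have tot: "arr_sum \<phi> a K n J B = (\<Sum>\<sigma>\<in>arrangements K n.
      if \<forall>j\<in>J. \<sigma> j \<in> B j then \<phi> (\<lambda>i. a (\<sigma> i)) else 0)" if "finite K" for K :: "'a set" and a n J B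
    unfolding arr_sum_def using finite_arrangements[OF that]
    by (subst sum.inter_filter[symmetric]) auto
  have "arr_sum \<phi> a (insert j K) (Suc n) (insert j J) B = (\<Sum>s<Suc n. \<Sum>\<sigma>\<in>arrangements K n.
      if s \<in> B j then if \<forall>i\<in>J. \<sigma> i \<in> skip s -` B i then \<phi> (\<lambda>i. (a \<circ> skip s) (\<sigma> i)) else 0 else 0)"
    unfolding tot[OF finite.insertI[OF K(1)]] sum_arrangements_insert[OF K(2)]
  proof (intro sum.cong refl)
    fix s \<sigma>
    let ?f = "\<lambda>i\<in>insert j K. if i = j then s else skip s (\<sigma> i)"
    have "\<phi> (\<lambda>i. a (?f i)) = \<phi> (\<lambda>i. (a \<circ> skip s) (\<sigma> i))"
      using K by (intro increasing_in_cong[OF \<phi>]) auto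
    moreover have "(\<forall>i\<in>insert j J. ?f i \<in> B i) \<longleftrightarrow> s \<in> B j \<and> (\<forall>i\<in>J. \<sigma> i \<in> skip s -` B i)"
    proof -
      have "?f i = skip s (\<sigma> i)" if "i \<in> J" for i using that K by auto
      then show ?thesis by auto
    qed
    ultimately show "(if \<forall>i\<in>insert j J. ?f i \<in> B i then \<phi> (\<lambda>i. a (?f i)) else 0) =
      (if s \<in> B j then if \<forall>i\<in>J. \<sigma> i \<in> skip s -` B i then \<phi> (\<lambda>i. (a \<circ> skip s) (\<sigma> i)) else 0 else 0)"
      by simp
  qed
  also have "\<dots> = (\<Sum>s<Suc n. if s \<in> B j then arr_sum \<phi> (a \<circ> skip s) K n J (\<lambda>i. skip s -` B i) else 0)"
    unfolding tot[OF K(1)] by (intro sum.cong) auto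
  also have "\<dots> = (\<Sum>s\<in>B j \<inter> {..<Suc n}. arr_sum \<phi> (a \<circ> skip s) K n J (\<lambda>i. skip s -` B i))"
    by (subst Int_commute, subst sum.inter_restrict) auto
  finally show ?thesis .
qed

lemma arr_count_insert:
  assumes K: "finite K" "j \<notin> K" "J \<subseteq> K"
  shows "arr_count (insert j K) (Suc n) (insert j J) B =
    (\<Sum>s\<in>B j \<inter> {..<Suc n}. arr_count K n J (\<lambda>i. skip s -` B i))"
  unfolding arr_count_conv_arr_sum[of _ _ _ _ "\<lambda>_. 0"]
  by (subst arr_sum_insert[OF K, of "{}"]) (auto simp: increasing_in_def comp_def)

section \<open>Regression dependence\<close>

lemma mono_comp_skip: "mono (a :: nat \<Rightarrow> real) \<Longrightarrow> mono (a \<circ> skip s)"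
  by (auto simp: mono_def skip_def)

text \<open>If \<open>a\<close> dominates \<open>b\<close> and the entry deleted from \<open>a\<close> is at most the one deleted from \<open>b\<close>, then
  \<open>a\<close> still dominates \<open>b\<close> after the deletions, wherever the two entries stand.\<close>

lemma skip_level_le:
  fixes a b :: "nat \<Rightarrow> real"
  assumes "mono a" "mono b" "\<And>i. b i \<le> a i" "a s \<le> b s'"
  shows "(b \<circ> skip s') i \<le> (a \<circ> skip s) i"
proof -
  have ma: "i \<le> k \<Longrightarrow> a i \<le> a k" and mb: "i \<le> k \<Longrightarrow> b i \<le> b k" for i k
    using assms by (auto dest: monoD)
  consider "i < s \<longleftrightarrow> i < s'" | "s \<le> i" "i < s'" | "s' \<le> i" "i < s" by linarith
  then show ?thesis
  proof cases
    case 1 then show ?thesis using assms(3) by (simp add: skip_def)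
  next
    case 2
    then show ?thesis using mb[of i "Suc i"] assms(3)[of "Suc i"] by (simp add: skip_def)
  next
    case 3
    then have "b (Suc i) \<le> b s" "b s' \<le> b i" by (auto intro: mb)
    then show ?thesis using 3 assms(3)[of s] assms(3)[of i] assms(4) by (simp add: skip_def)
  qed
qed

text \<open>Negative regression dependence of a uniform arrangement, with denominators cleared. Two value
  sequences \<open>b \<le> a\<close> are needed for the induction over \<open>J\<close>: deleting the value \<open>x j\<close> from one and
  \<open>y j\<close> from the other makes them differ even if they agree at first.\<close>

lemma arr_sum_level_sets:
  fixes a b :: "nat \<Rightarrow> real" and x y :: "'i \<Rightarrow> real"
  assumes "finite K" "card K = n" "J \<subseteq> K" "I \<subseteq> K - J" "increasing_in I \<phi>"
    and "mono a" "mono b" "\<And>i. b i \<le> a i" "\<And>j. j \<in> J \<Longrightarrow> x j \<le> y j"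
  shows "arr_sum \<phi> b K n J (\<lambda>j. b -` {y j}) * arr_count K n J (\<lambda>j. a -` {x j})
       \<le> arr_sum \<phi> a K n J (\<lambda>j. a -` {x j}) * arr_count K n J (\<lambda>j. b -` {y j})"
  using finite_subset[OF assms(3,1)] assms
proof (induction J arbitrary: K n a b rule: finite_induct)
  case empty
  have "arr_count K n {} (\<lambda>j. a -` {x j}) = arr_count K n {} (\<lambda>j. b -` {y j})"
    by (simp add: arr_count_def)
  moreover have "arr_sum \<phi> b K n {} (\<lambda>j. b -` {y j}) \<le> arr_sum \<phi> a K n {} (\<lambda>j. a -` {x j})"
    using arr_sum_mono[OF empty.prems(5), of b a K n "{}"] empty.prems(8) by (simp add: arr_sum_def)
  ultimately show ?case using arr_count_nonneg by (metis mult_right_mono)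
next
  case (insert j J)
  define L where "L = K - {j}"
  obtain m where n: "n = Suc m" and m: "card L = m"
    using insert.prems(1-3) by (cases n) (auto simp: L_def)
  have L: "finite L" "j \<notin> L" "J \<subseteq> L" "I \<subseteq> L - J" "I \<subseteq> L" and K: "K = insert j L"
    using insert.prems(1-4) insert.hyps by (auto simp: L_def)
  define ta where "ta s = arr_sum \<phi> (a \<circ> skip s) L m J (\<lambda>i. (a \<circ> skip s) -` {x i})" for s
  define tb where "tb s = arr_sum \<phi> (b \<circ> skip s) L m J (\<lambda>i. (b \<circ> skip s) -` {y i})" for s
  define na where "na s = arr_count L m J (\<lambda>i. (a \<circ> skip s) -` {x i})" for s
  define nb where "nb s = arr_count L m J (\<lambda>i. (b \<circ> skip s) -` {y i})" for s
  let ?A = "a -` {x j} \<inter> {..<Suc m}" and ?B = "b -` {y j} \<inter> {..<Suc m}"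
  have le: "tb s' * na s \<le> ta s * nb s'" if "s \<in> ?A" "s' \<in> ?B" for s s'
    unfolding ta_def tb_def na_def nb_def
  proof (rule insert.IH[OF L(1) m L(3,4) insert.prems(5)])
    show "mono (a \<circ> skip s)" "mono (b \<circ> skip s')" using insert.prems by (auto intro: mono_comp_skip)
    show "(b \<circ> skip s') i \<le> (a \<circ> skip s) i" for i
      using that insert.prems(9)[of j] by (intro skip_level_le insert.prems) auto
    show "\<And>j. j \<in> J \<Longrightarrow> x j \<le> y j" using insert.prems by auto
  qed
  have "(\<Sum>s'\<in>?B. tb s') * (\<Sum>s\<in>?A. na s) \<le> (\<Sum>s\<in>?A. ta s) * (\<Sum>s'\<in>?B. nb s')"
    unfolding sum_product by (subst sum.swap) (intro sum_mono le)
  then show ?case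
    unfolding K n arr_sum_insert[OF L(1-3,5) insert.prems(5)] arr_count_insert[OF L(1-3)]
    by (simp add: ta_def tb_def na_def nb_def vimage_comp comp_def)
qed

section \<open>Tail dependence\<close>

text \<open>Negative left-tail dependence of a uniform arrangement, the conditions being upper bounds on
  ranks and denominators cleared. The bounds are raised one coordinate \<open>j\<close> at a time. Raising the
  bound of \<open>j\<close> only adds ranks \<open>s'\<close> for \<open>j\<close> that exceed all ranks \<open>s\<close> allowed before. Given that \<open>j\<close>
  has rank \<open>s'\<close> instead of \<open>s\<close>, the other members share smaller values, while their bounds, counted
  on the remaining ranks, can only be larger; by induction the conditional expectation of \<open>\<phi>\<close> is
  not larger. So the new ranks can only pull the average down.\<close>

lemma arr_sum_lower_sets:
  fixes a :: "nat \<Rightarrow> real" and m m' :: "'i \<Rightarrow> nat"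
  assumes "finite K" "card K = n" "J \<subseteq> K" "I \<subseteq> K - J" "increasing_in I \<phi>"
    and "mono a" "\<And>j. j \<in> J \<Longrightarrow> m j \<le> m' j"
  shows "arr_sum \<phi> a K n J (\<lambda>j. {..<m' j}) * arr_count K n J (\<lambda>j. {..<m j})
       \<le> arr_sum \<phi> a K n J (\<lambda>j. {..<m j}) * arr_count K n J (\<lambda>j. {..<m' j})"
  using finite_subset[OF assms(3,1)] assms
proof (induction J arbitrary: K n a m m' rule: finite_psubset_induct)
  case (psubset J)
  define T where "T m = arr_sum \<phi> a K n J (\<lambda>j. {..<m j})" for m :: "'i \<Rightarrow> nat"
  define N where "N m = arr_count K n J (\<lambda>j. {..<m j})" for m :: "'i \<Rightarrow> nat"
  have one: "T (q(j := c)) * N q \<le> T q * N (q(j := c))" if j: "j \<in> J" and c: "q j \<le> c" for q j c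
  proof -
    define L where "L = K - {j}"
    define J' where "J' = J - {j}"
    obtain d where n: "n = Suc d" and d: "card L = d"
      using psubset.prems(1-3) j by (cases n) (auto simp: L_def)
    have L: "finite L" "j \<notin> L" "J' \<subseteq> L" "I \<subseteq> L - J'" "I \<subseteq> L"
      and K: "K = insert j L" and J: "J = insert j J'" and J': "J' \<subset> J"
      using psubset.prems(1-4) j by (auto simp: L_def J'_def)
    \<comment> \<open>The bound on \<open>i\<close> once \<open>j\<close> has rank \<open>s\<close> and the other ranks are relabelled.\<close>
    define r where "r s i = (if s < q i then q i - 1 else q i)" for s i
    have r: "skip s -` {..<q i} = {..<r s i}" for s i
      by (auto simp: r_def skip_def split: if_splits)
    define t where "t s = arr_sum \<phi> (a \<circ> skip s) L d J' (\<lambda>i. {..<r s i})" for s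
    define u where "u s = arr_count L d J' (\<lambda>i. {..<r s i})" for s
    have le: "t s' * u s \<le> t s * u s'" if "s \<le> s'" for s s'
    proof -
      have "t s' \<le> arr_sum \<phi> (a \<circ> skip s) L d J' (\<lambda>i. {..<r s' i})"
        unfolding t_def using psubset.prems(6) that
        by (intro arr_sum_mono[OF psubset.prems(5)]) (auto simp: skip_def intro: monoD)
      then have "t s' * u s \<le> arr_sum \<phi> (a \<circ> skip s) L d J' (\<lambda>i. {..<r s' i}) * u s"
        by (intro mult_right_mono) (auto simp: u_def arr_count_nonneg)
      also have "\<dots> \<le> t s * u s'"
        unfolding t_def u_def
        by (rule psubset.IH[OF J' L(1) d L(3,4) psubset.prems(5)])
           (use that mono_comp_skip[OF psubset.prems(6)] in \<open>auto simp: r_def comp_def\<close>)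
      finally show ?thesis .
    qed
    have T_eq: "T (q(j := e)) = (\<Sum>s\<in>{..<e} \<inter> {..<Suc d}. t s)" for e
    proof -
      have "arr_sum \<phi> (a \<circ> skip s) L d J' (\<lambda>i. skip s -` {..<(q(j := e)) i}) = t s" for s
        unfolding t_def by (rule arr_sum_cong) (auto simp: J'_def r)
      then show ?thesis
        unfolding T_def K n J arr_sum_insert[OF L(1-3,5) psubset.prems(5)] by simp
    qed
    have N_eq: "N (q(j := e)) = (\<Sum>s\<in>{..<e} \<inter> {..<Suc d}. u s)" for e
    proof -
      have "arr_count L d J' (\<lambda>i. skip s -` {..<(q(j := e)) i}) = u s" for s
        unfolding u_def by (rule arr_count_cong) (auto simp: J'_def r)
      then show ?thesis
        unfolding N_def K n J arr_count_insert[OF L(1-3)] by simp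
    qed
    let ?A = "{..<q j} \<inter> {..<Suc d}" and ?D = "{q j..<c} \<inter> {..<Suc d}"
    have AD: "{..<c} \<inter> {..<Suc d} = ?A \<union> ?D" using c by auto
    have un: "(\<Sum>s\<in>?A \<union> ?D. f s) = sum f ?A + sum f ?D" for f :: "nat \<Rightarrow> real"
      by (rule sum.union_disjoint) auto
    have "sum t ?D * sum u ?A \<le> sum t ?A * sum u ?D"
      unfolding sum_product by (subst sum.swap) (intro sum_mono le, auto)
    then show ?thesis
      using T_eq[of "q j"] N_eq[of "q j"] unfolding T_eq[of c] N_eq[of c] AD un
      by (simp add: algebra_simps)
  qed
  \<comment> \<open>If the count for \<open>m\<close> is zero, both sides vanish. Otherwise the counts in the middle, which are at
    least as large, can be cancelled when two inequalities are combined.\<close>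
  have chain: "T (\<lambda>i. if i \<in> F then m' i else m i) * N m \<le> T m * N (\<lambda>i. if i \<in> F then m' i else m i)"
    if F: "finite F" "F \<subseteq> J" for F
    using F
  proof (induction F rule: finite_induct)
    case empty then show ?case by simp
  next
    case (insert j F)
    define q where "q = (\<lambda>i. if i \<in> F then m' i else m i)"
    have q': "(\<lambda>i. if i \<in> insert j F then m' i else m i) = q(j := m' j)"
      by (auto simp: q_def fun_eq_iff)
    have IH: "T q * N m \<le> T m * N q" using insert by (simp add: q_def)
    have step: "T (q(j := m' j)) * N q \<le> T q * N (q(j := m' j))"
      using insert.prems insert.hyps psubset.prems(7)[of j] by (intro one) (auto simp: q_def)
    show ?case
    proof (cases "N m = 0")
      case True
      then have "T m = 0" unfolding T_def N_def by (intro arr_sum_eq_0 psubset.prems)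
      with True show ?thesis by simp
    next
      case False
      have "N m \<le> N q"
        unfolding N_def using psubset.prems(7) insert.prems
        by (intro arr_count_mono psubset.prems(1)) (auto simp: q_def dest: order.strict_trans2)
      then have pos: "0 < N m" "0 < N q" using False arr_count_nonneg[of K n J "\<lambda>j. {..<m j}"]
        by (auto simp: N_def)
      have nn: "0 \<le> N (q(j := m' j))" by (simp add: N_def arr_count_nonneg)
      have "(T (q(j := m' j)) * N m) * N q \<le> (T q * N (q(j := m' j))) * N m"
        using mult_right_mono[OF step, of "N m"] pos by (simp add: mult_ac)
      also have "\<dots> \<le> (T m * N (q(j := m' j))) * N q"
        using mult_right_mono[OF IH nn] by (simp add: mult_ac)
      finally show ?thesis unfolding q' using pos by simp
    qed
  qed
  have "T (\<lambda>i. if i \<in> J then m' i else m i) = T m'" "N (\<lambda>i. if i \<in> J then m' i else m i) = N m'"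
    unfolding T_def N_def by (auto intro!: arr_sum_cong arr_count_cong)
  with chain[OF psubset.hyps order.refl] show ?case by (simp add: T_def N_def)
qed

lemma arr_sum_cong_below:
  assumes "J \<subseteq> K" "\<And>j. j \<in> J \<Longrightarrow> B j \<inter> {..<n} = B' j \<inter> {..<n}"
  shows "arr_sum \<phi> a K n J B = arr_sum \<phi> a K n J B'"
proof -
  have "(\<forall>j\<in>J. \<sigma> j \<in> B j) \<longleftrightarrow> (\<forall>j\<in>J. \<sigma> j \<in> B' j)" if "\<sigma> \<in> arrangements K n" for \<sigma>
  proof -
    have "\<sigma> j \<in> {..<n}" if "j \<in> J" for j
      using that \<open>\<sigma> \<in> _\<close> assms(1) by (auto simp: arrangements_def bij_betw_def)
    then show ?thesis using assms(2) by blast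
  qed
  then show ?thesis unfolding arr_sum_def by (intro sum.cong) auto
qed

text \<open>The same for initial segments of the ranks, which need not be bounded by \<open>n\<close>.\<close>

lemma arr_sum_down_sets:
  fixes a :: "nat \<Rightarrow> real" and D D' :: "'i \<Rightarrow> nat set"
  assumes K: "finite K" "card K = n" "J \<subseteq> K" "I \<subseteq> K - J" and \<phi>: "increasing_in I \<phi>"
    and a: "mono a"
    and D: "\<And>j s t. j \<in> J \<Longrightarrow> t \<in> D j \<Longrightarrow> s \<le> t \<Longrightarrow> s \<in> D j"
    and D': "\<And>j s t. j \<in> J \<Longrightarrow> t \<in> D' j \<Longrightarrow> s \<le> t \<Longrightarrow> s \<in> D' j"
    and sub: "\<And>j. j \<in> J \<Longrightarrow> D j \<subseteq> D' j"
  shows "arr_sum \<phi> a K n J D' * arr_count K n J D \<le> arr_sum \<phi> a K n J D * arr_count K n J D'"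
proof -
  \<comment> \<open>Below \<open>n\<close>, an initial segment \<open>E\<close> consists of the ranks less than \<open>m E\<close>.\<close>
  define m where "m E = (LEAST k. k = n \<or> k \<notin> E)" for E :: "nat set"
  have m: "m E = n \<or> m E \<notin> E" for E
    unfolding m_def by (rule LeastI[where k = n]) simp
  have below: "E \<inter> {..<n} = {..<m E} \<inter> {..<n}"
    if "\<And>s t. t \<in> E \<Longrightarrow> s \<le> t \<Longrightarrow> s \<in> E" for E
  proof -
    have "s \<in> E \<longleftrightarrow> s < m E" if "s < n" for s
    proof
      assume "s < m E" then show "s \<in> E"
        unfolding m_def by (metis (mono_tags, lifting) not_less_Least)
    next
      assume "s \<in> E" then show "s < m E"
        using m[of E] \<open>s < n\<close> \<open>\<And>s t. t \<in> E \<Longrightarrow> s \<le> t \<Longrightarrow> s \<in> E\<close> by (meson not_less)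
    qed
    then show ?thesis by auto
  qed
  have le: "m (D j) \<le> m (D' j)" if "j \<in> J" for j
    using m[of "D' j"] sub[OF that] unfolding m_def[of "D j"] by (intro Least_le) auto
  have bD: "D j \<inter> {..<n} = {..<m (D j)} \<inter> {..<n}" if "j \<in> J" for j
    by (rule below) (rule D[OF that])
  have bD': "D' j \<inter> {..<n} = {..<m (D' j)} \<inter> {..<n}" if "j \<in> J" for j
    by (rule below) (rule D'[OF that])
  have "arr_sum \<psi> b K n J D = arr_sum \<psi> b K n J (\<lambda>j. {..<m (D j)})"
       "arr_sum \<psi> b K n J D' = arr_sum \<psi> b K n J (\<lambda>j. {..<m (D' j)})" for \<psi> b
    by (rule arr_sum_cong_below[OF K(3)], erule bD bD')+
  note eq = this
  show ?thesis
    unfolding arr_count_conv_arr_sum[of _ _ _ _ a] eq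
    unfolding arr_count_conv_arr_sum[of _ _ _ _ a, symmetric]
    by (rule arr_sum_lower_sets[OF K \<phi> a le])
qed

lemma arr_sum_reverse:
  assumes I: "I \<subseteq> K" and J: "J \<subseteq> K" and \<phi>: "increasing_in I \<phi>"
  shows "arr_sum \<phi> a K n J B = arr_sum \<phi> (\<lambda>s. a (n - 1 - s)) K n J (\<lambda>j. {s. n - 1 - s \<in> B j})"
proof -
  define r where "r \<sigma> = (\<lambda>i\<in>K. n - 1 - \<sigma> i)" for \<sigma> :: "'a \<Rightarrow> nat"
  have bij: "bij_betw (\<lambda>s. n - 1 - s) {..<n} {..<n}"
    by (rule bij_betwI[where g = "\<lambda>s. n - 1 - s"]) auto
  have r_arr: "r \<sigma> \<in> arrangements K n" if "\<sigma> \<in> arrangements K n" for \<sigma>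
    using that bij_betw_trans[OF _ bij, of \<sigma> K]
    by (auto simp: arrangements_def r_def comp_def cong: bij_betw_cong)
  have lt: "\<sigma> i < n" if "\<sigma> \<in> arrangements K n" "i \<in> K" for \<sigma> i
    using that by (auto simp: arrangements_def bij_betw_def)
  have idem: "n - 1 - (n - 1 - \<sigma> i) = \<sigma> i" if "\<sigma> \<in> arrangements K n" "i \<in> K" for \<sigma> i
    using lt[OF that] by auto
  have rr: "r (r \<sigma>) = \<sigma>" if "\<sigma> \<in> arrangements K n" for \<sigma>
    using that idem[OF that] by (auto simp: arrangements_def r_def fun_eq_iff extensional_def)
  show ?thesis
    unfolding arr_sum_def
  proof (rule sum.reindex_bij_witness[where i = r and j = r])
    fix \<sigma> assume s: "\<sigma> \<in> {\<sigma> \<in> arrangements K n. \<forall>j\<in>J. \<sigma> j \<in> B j}"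
    then show "r (r \<sigma>) = \<sigma>" using rr by auto
    have "r \<sigma> j \<in> {s. n - 1 - s \<in> B j}" if "j \<in> J" for j
    proof -
      have "r \<sigma> j = n - 1 - \<sigma> j" using that J by (auto simp: r_def)
      then show ?thesis using s that J idem[of \<sigma> j] by auto
    qed
    then show "r \<sigma> \<in> {\<sigma> \<in> arrangements K n. \<forall>j\<in>J. \<sigma> j \<in> {s. n - 1 - s \<in> B j}}"
      using s r_arr by simp
    show "\<phi> (\<lambda>i. a (n - 1 - r \<sigma> i)) = \<phi> (\<lambda>i. a (\<sigma> i))"
      using s idem[of \<sigma>] I by (intro increasing_in_cong[OF \<phi>]) (auto simp: r_def)
  next
    fix \<sigma> assume s: "\<sigma> \<in> {\<sigma> \<in> arrangements K n. \<forall>j\<in>J. \<sigma> j \<in> {s. n - 1 - s \<in> B j}}"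
    then show "r (r \<sigma>) = \<sigma>" using rr by auto
    have "r \<sigma> j \<in> B j" if "j \<in> J" for j
      using s that J by (auto simp: r_def)
    then show "r \<sigma> \<in> {\<sigma> \<in> arrangements K n. \<forall>j\<in>J. \<sigma> j \<in> B j}"
      using s r_arr by simp
  qed
qed

text \<open>Negative right-tail dependence of a uniform arrangement: reversing the ranks and negating the
  values turns final segments into initial ones.\<close>

lemma arr_sum_up_sets:
  fixes a :: "nat \<Rightarrow> real" and B B' :: "'i \<Rightarrow> nat set"
  assumes K: "finite K" "card K = n" "J \<subseteq> K" "I \<subseteq> K - J" and \<phi>: "increasing_in I \<phi>"
    and a: "mono a"
    and B: "\<And>j s t. j \<in> J \<Longrightarrow> s \<in> B j \<Longrightarrow> s \<le> t \<Longrightarrow> t \<in> B j"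
    and B': "\<And>j s t. j \<in> J \<Longrightarrow> s \<in> B' j \<Longrightarrow> s \<le> t \<Longrightarrow> t \<in> B' j"
    and sub: "\<And>j. j \<in> J \<Longrightarrow> B' j \<subseteq> B j"
  shows "arr_sum \<phi> a K n J B' * arr_count K n J B \<le> arr_sum \<phi> a K n J B * arr_count K n J B'"
proof -
  define b where "b s = - a (n - 1 - s)" for s
  define \<psi> where "\<psi> u = - \<phi> (\<lambda>i. - u i)" for u
  define rv where "rv E j = {s. n - 1 - s \<in> E j}" for E :: "'i \<Rightarrow> nat set" and j
  have \<psi>: "increasing_in I \<psi>" using \<phi> by (auto simp: increasing_in_def \<psi>_def)
  have b: "mono b" using a by (auto simp: mono_def b_def)
  have s: "arr_sum \<phi> a K n J E = - arr_sum \<psi> b K n J (rv E)" for E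
    using K(4) arr_sum_reverse[OF _ K(3) \<phi>, of a n E]
    by (auto simp: arr_sum_def \<psi>_def b_def rv_def sum_negf)
  have c: "arr_count K n J E = arr_count K n J (rv E)" for E
    using arr_sum_reverse[of "{}" K J "\<lambda>_. 1" "\<lambda>_. 0" n E] K(3)
    by (simp add: arr_count_conv_arr_sum[of _ _ _ _ "\<lambda>_. 0"] rv_def[abs_def] increasing_in_def)
  have "arr_sum \<psi> b K n J (rv B) * arr_count K n J (rv B')
      \<le> arr_sum \<psi> b K n J (rv B') * arr_count K n J (rv B)"
  proof (rule arr_sum_down_sets[OF K \<psi> b])
    show "s \<in> rv B' j" if "j \<in> J" "t \<in> rv B' j" "s \<le> t" for j s t
      using B'[OF that(1), of "n - 1 - t" "n - 1 - s"] that by (auto simp: rv_def)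
    show "s \<in> rv B j" if "j \<in> J" "t \<in> rv B j" "s \<le> t" for j s t
      using B[OF that(1), of "n - 1 - t" "n - 1 - s"] that by (auto simp: rv_def)
    show "rv B' j \<subseteq> rv B j" if "j \<in> J" for j using sub[OF that] by (auto simp: rv_def)
  qed
  then show ?thesis unfolding s[of B] s[of B'] c[of B] c[of B'] by simp
qed

section \<open>Symmetry of the tournament under renaming the players\<close>

lemma finite_pairings: "finite A \<Longrightarrow> finite (pairings A)"
  by (rule finite_subset[OF _ finitely_many_partition_on[of A]]) (auto simp: pairings_def)

lemma pairings_nonempty: "finite A \<Longrightarrow> card A = 2 * m \<Longrightarrow> pairings A \<noteq> {}"
proof (induction m arbitrary: A)
  case 0
  then have "{} \<in> pairings A" by (auto simp: pairings_def partition_on_empty)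
  then show ?case by blast
next
  case (Suc m)
  then obtain i where i: "i \<in> A" by (metis card.empty equals0I mult_is_0 nat.distinct(1) zero_neq_numeral)
  then have "card (A - {i}) = Suc (2 * m)" using Suc.prems by simp
  then obtain j where j: "j \<in> A" "j \<noteq> i"
    by (metis Diff_iff card.empty equals0I insertI1 nat.distinct(1))
  have "card (A - {i, j}) = 2 * m" using Suc.prems i j by (simp add: card_Diff_subset)
  with Suc obtain M where M: "M \<in> pairings (A - {i, j})" by blast
  then have "\<Union>M = A - {i, j}" by (auto simp: pairings_def partition_on_def)
  then have "insert {i, j} M \<in> pairings A"
    using M i j by (auto simp: pairings_def partition_on_insert disjnt_def)
  then show ?case by blast
qed

lemma pairings_image_subset:
  assumes "inj_on \<pi> A" "M \<in> pairings A"
  shows "(`) \<pi> ` M \<in> pairings (\<pi> ` A)"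
proof -
  have P: "partition_on A M" and c: "\<And>e. e \<in> M \<Longrightarrow> card e = 2"
    using assms(2) by (auto simp: pairings_def)
  have e: "e \<subseteq> A" if "e \<in> M" for e using P that by (auto simp: partition_on_def)
  have "{} \<notin> (`) \<pi> ` M" using c by force
  with partition_on_inj_image[OF P assms(1)] have "partition_on (\<pi> ` A) ((`) \<pi> ` M)" by simp
  moreover have "card (\<pi> ` e) = 2" if "e \<in> M" for e
    using c[OF that] card_image[OF inj_on_subset[OF assms(1) e[OF that]]] by simp
  ultimately show ?thesis by (auto simp: pairings_def)
qed

text \<open>Renaming the players by \<open>\<pi>\<close> acts on sets of matches as \<open>(`) ((`) \<pi>)\<close>.\<close>

lemma bij_betw_pairings:
  assumes "bij \<pi>"
  shows "bij_betw ((`) ((`) \<pi>)) (pairings A) (pairings (\<pi> ` A))"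
proof (rule bij_betwI[where g = "(`) ((`) (inv \<pi>))"])
  have inj: "inj \<pi>" "inj (inv \<pi>)" using assms by (auto simp: bij_is_inj bij_imp_bij_inv)
  show "(`) ((`) \<pi>) \<in> pairings A \<rightarrow> pairings (\<pi> ` A)"
    using inj by (auto intro!: pairings_image_subset inj_on_subset[OF inj(1)])
  have "inv \<pi> ` \<pi> ` A = A" using inj by (simp add: image_image)
  then show "(`) ((`) (inv \<pi>)) \<in> pairings (\<pi> ` A) \<rightarrow> pairings A"
    using pairings_image_subset[OF inj_on_subset[OF inj(2)], of "\<pi> ` A"] by auto
  show "(`) ((`) (inv \<pi>)) ((`) ((`) \<pi>) M) = M" for M
    using inj by (simp add: image_image)
  show "(`) ((`) \<pi>) ((`) ((`) (inv \<pi>)) M) = M" for M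
    using bij_is_surj[OF assms] by (simp add: image_image surj_f_inv_f)
qed

lemma finite_PiE_dflt_self:
  fixes M :: "nat set set"
  assumes "finite M" "\<And>e. e \<in> M \<Longrightarrow> card e = 2"
  shows "finite (PiE_dflt M 0 (\<lambda>e. e))" "PiE_dflt M 0 (\<lambda>e. e) \<noteq> {}"
proof -
  have e: "finite e" "e \<noteq> {}" if "e \<in> M" for e
    using assms(2)[OF that] by (force intro: card_ge_0_finite)+
  show "finite (PiE_dflt M 0 (\<lambda>e. e))" using assms(1) e by (intro finite_PiE_dflt)
  have "(\<lambda>e. if e \<in> M then SOME i. i \<in> e else 0) \<in> PiE_dflt M 0 (\<lambda>e. e)"
    using e(2) by (simp add: PiE_dflt_def some_in_eq)
  then show "PiE_dflt M 0 (\<lambda>e. e) \<noteq> {}" by blast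
qed

lemma duel_half:
  assumes "card e = 2" "e \<subseteq> U" "\<And>i j. i \<in> U \<Longrightarrow> j \<in> U \<Longrightarrow> i \<noteq> j \<Longrightarrow> p i j = 1 / 2"
  shows "duel p e = pmf_of_set e"
proof -
  obtain i j where e: "e = {i, j}" "i \<noteq> j" using assms(1) by (auto simp: card_2_iff)
  have mm: "Min e \<noteq> Max e" "{Max e, Min e} = e" "Min e \<in> U" "Max e \<in> U"
    using e assms(2) by (auto simp: min_def max_def)
  have "duel p e = map_pmf (\<lambda>b. if b then Min e else Max e) (pmf_of_set UNIV)"
    unfolding duel_def assms(3)[OF mm(3,4,1)] bernoulli_pmf_half_conv_pmf_of_set ..
  also have "\<dots> = pmf_of_set ((\<lambda>b. if b then Min e else Max e) ` UNIV)"
    using mm by (intro map_pmf_of_set_inj) (auto simp: inj_def)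
  also have "(\<lambda>b. if b then Min e else Max e) ` UNIV = e"
    using mm(2) by (auto simp: UNIV_bool)
  finally show ?thesis .
qed

text \<open>Players from \<open>U\<close> are of equal strength. Nothing is assumed about \<open>p\<close> outside \<open>U\<close>, so statements
  about a set \<open>A\<close> of players require \<open>A \<subseteq> U\<close>.\<close>

locale fair =
  fixes p :: "nat \<Rightarrow> nat \<Rightarrow> real" and U :: "nat set"
  assumes finite_U: "finite U"
    and fair: "\<And>i j. i \<in> U \<Longrightarrow> j \<in> U \<Longrightarrow> i \<noteq> j \<Longrightarrow> p i j = 1 / 2"
begin

lemma play_round_eq:
  assumes A: "A \<subseteq> U" "card A = 2 * m"
  shows "play_round p A = bind_pmf (pmf_of_set (pairings A))
    (\<lambda>M. map_pmf (Pair M) (pmf_of_set (PiE_dflt M 0 (\<lambda>e. e))))"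
proof -
  have fA: "finite A" using A(1) finite_U finite_subset by blast
  have "Pi_pmf M 0 (duel p) = pmf_of_set (PiE_dflt M 0 (\<lambda>e. e))" if "M \<in> pairings A" for M
  proof -
    have M: "finite M" "\<And>e. e \<in> M \<Longrightarrow> card e = 2 \<and> e \<subseteq> U"
      using that fA A finite_elements[of A M] by (auto simp: pairings_def partition_on_def)
    have fe: "finite e" "e \<noteq> {}" if "e \<in> M" for e
      using M(2)[OF that] by (force intro: card_ge_0_finite)+
    have "Pi_pmf M 0 (duel p) = Pi_pmf M 0 (\<lambda>e. pmf_of_set e)"
      using M fair by (intro Pi_pmf_cong refl duel_half[of _ U]) auto
    also have "\<dots> = pmf_of_set (PiE_dflt M 0 (\<lambda>e. e))"
      using M(1) fe by (intro Pi_pmf_of_set)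
    finally show ?thesis .
  qed
  moreover have "set_pmf (pmf_of_set (pairings A)) = pairings A"
    using finite_pairings[OF fA] pairings_nonempty[OF fA A(2)] by simp
  ultimately show ?thesis
    unfolding play_round_def map_pmf_def by (intro bind_pmf_cong[OF refl]) simp
qed

text \<open>The identity holds already given the matches: the tuples of winners correspond under \<open>h\<close>, and
  both sides are uniform.\<close>

lemma winners_equivariant:
  assumes A: "A \<subseteq> U" "\<pi> ` A \<subseteq> U" "card A = 2 * m" and \<pi>: "bij \<pi>"
  shows "map_pmf winners (play_round p (\<pi> ` A)) = map_pmf ((`) \<pi>) (map_pmf winners (play_round p A))"
proof -
  have fA: "finite A" using A(1) finite_U finite_subset by blast
  have inj: "inj \<pi>" and surj: "surj \<pi>" using \<pi> by (auto simp: bij_is_inj bij_is_surj)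
  have card': "card (\<pi> ` A) = 2 * m" using A(3) inj by (simp add: card_image inj_on_subset)
  define W where "W M = map_pmf (\<lambda>w. w ` M) (pmf_of_set (PiE_dflt M 0 (\<lambda>e :: nat set. e)))" for M
  have *: "map_pmf winners (play_round p B) = bind_pmf (pmf_of_set (pairings B)) W"
    if "B \<subseteq> U" "card B = 2 * m" for B
    unfolding play_round_eq[OF that] map_bind_pmf W_def
    by (simp add: pmf.map_comp comp_def winners_def)
  have W: "W ((`) \<pi> ` M) = map_pmf ((`) \<pi>) (W M)" if M: "M \<in> pairings A" for M
  proof -
    have M: "finite M" "\<And>e. e \<in> M \<Longrightarrow> card e = 2"
      using that fA finite_elements[of A M] by (auto simp: pairings_def)
    define h where "h w e = (if e \<in> (`) \<pi> ` M then \<pi> (w (\<pi> -` e)) else 0)" for w :: "nat set \<Rightarrow> nat" and e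
    have vim: "\<pi> -` \<pi> ` e = e" for e using inj by (simp add: inj_vimage_image_eq)
    have hw: "h w ` (`) \<pi> ` M = \<pi> ` w ` M" for w
      by (auto simp: h_def image_image vim)
    have "bij_betw h (PiE_dflt M 0 (\<lambda>e. e)) (PiE_dflt ((`) \<pi> ` M) 0 (\<lambda>e. e))"
    proof (rule bij_betwI[where g = "\<lambda>w e. if e \<in> M then inv \<pi> (w (\<pi> ` e)) else 0"])
      show "h \<in> PiE_dflt M 0 (\<lambda>e. e) \<rightarrow> PiE_dflt ((`) \<pi> ` M) 0 (\<lambda>e. e)"
        by (auto simp: PiE_dflt_def h_def vim)
      have "inv \<pi> (w (\<pi> ` e)) \<in> e" if "w (\<pi> ` e) \<in> \<pi> ` e" for w e
        using that inj by auto
      then show "(\<lambda>w e. if e \<in> M then inv \<pi> (w (\<pi> ` e)) else 0)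
          \<in> PiE_dflt ((`) \<pi> ` M) 0 (\<lambda>e. e) \<rightarrow> PiE_dflt M 0 (\<lambda>e. e)"
        by (auto simp: PiE_dflt_def)
      show "(\<lambda>e. if e \<in> M then inv \<pi> (h w (\<pi> ` e)) else 0) = w" if "w \<in> PiE_dflt M 0 (\<lambda>e. e)" for w
        using that inj by (auto simp: PiE_dflt_def h_def vim fun_eq_iff)
      show "h (\<lambda>e. if e \<in> M then inv \<pi> (w (\<pi> ` e)) else 0) = w"
        if "w \<in> PiE_dflt ((`) \<pi> ` M) 0 (\<lambda>e. e)" for w
        using that surj by (auto simp: PiE_dflt_def h_def vim fun_eq_iff surj_f_inv_f)
    qed
    moreover note finite_PiE_dflt_self(2,1)[OF M]
    ultimately have "pmf_of_set (PiE_dflt ((`) \<pi> ` M) 0 (\<lambda>e. e)) = map_pmf h (pmf_of_set (PiE_dflt M 0 (\<lambda>e. e)))"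
      by (rule map_pmf_of_set_bij_betw[symmetric])
    then show ?thesis by (simp add: W_def pmf.map_comp comp_def hw)
  qed
  have "pmf_of_set (pairings (\<pi> ` A)) = map_pmf ((`) ((`) \<pi>)) (pmf_of_set (pairings A))"
    using finite_pairings[OF fA] pairings_nonempty[OF fA A(3)]
    by (intro map_pmf_of_set_bij_betw[symmetric] bij_betw_pairings \<pi>) auto
  then have "map_pmf winners (play_round p (\<pi> ` A)) =
      bind_pmf (pmf_of_set (pairings A)) (\<lambda>M. W ((`) \<pi> ` M))"
    using *[OF A(2) card'] by (simp add: bind_map_pmf)
  also have "\<dots> = bind_pmf (pmf_of_set (pairings A)) (\<lambda>M. map_pmf ((`) \<pi>) (W M))"
    using finite_pairings[OF fA] pairings_nonempty[OF fA A(3)] W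
    by (intro bind_pmf_cong) auto
  also have "\<dots> = map_pmf ((`) \<pi>) (map_pmf winners (play_round p A))"
    using *[OF A(1,3)] by (simp add: map_bind_pmf)
  finally show ?thesis .
qed

lemma play_round_support:
  assumes A: "A \<subseteq> U" "card A = 2 * m" and r: "(M, w) \<in> set_pmf (play_round p A)"
  shows "winners (M, w) \<subseteq> A" "card (winners (M, w)) = m"
    "card {e \<in> M. w e = i} = of_bool (i \<in> winners (M, w))"
proof -
  have fA: "finite A" using A(1) finite_U finite_subset by blast
  have "M \<in> pairings A \<and> w \<in> set_pmf (pmf_of_set (PiE_dflt M 0 (\<lambda>e. e)))"
    using r finite_pairings[OF fA] pairings_nonempty[OF fA A(2)]
    unfolding play_round_eq[OF A] by auto
  then have P: "partition_on A M" and c: "\<And>e. e \<in> M \<Longrightarrow> card e = 2"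
      and "w \<in> set_pmf (pmf_of_set (PiE_dflt M 0 (\<lambda>e. e)))"
    by (auto simp: pairings_def)
  moreover have fM: "finite M" using P fA finite_elements by blast
  have fe: "finite e" if "e \<in> M" for e using c[OF that] by (auto intro: card_ge_0_finite)
  ultimately have w: "w e \<in> e" if "e \<in> M" for e
    using that finite_PiE_dflt_self[OF fM c] by (auto simp: PiE_dflt_def)
  have disj: "e = e'" if "e \<in> M" "e' \<in> M" "i \<in> e" "i \<in> e'" for e e' i
    using P that by (auto simp: partition_on_def disjoint_def)
  have inj: "inj_on w M" using w disj by (metis inj_onI)
  show "winners (M, w) \<subseteq> A" using w P by (auto simp: winners_def partition_on_def)
  have "card A = (\<Sum>e\<in>M. card e)" using P fe by (intro product_partition) auto
  then have "card M = m" using A(2) c by simp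
  then show "card (winners (M, w)) = m" using inj by (simp add: winners_def card_image)
  show "card {e \<in> M. w e = i} = of_bool (i \<in> winners (M, w))"
  proof (cases "i \<in> winners (M, w)")
    case True
    then obtain e where "e \<in> M" "w e = i" by (auto simp: winners_def)
    then have "{e \<in> M. w e = i} = {e}" using inj by (auto dest: inj_onD)
    then show ?thesis using True by simp
  next
    case False
    then have "{e \<in> M. w e = i} = {}" by (auto simp: winners_def)
    then show ?thesis using False by (simp only: card.empty of_bool_eq)
  qed
qed

text \<open>The joint law of the numbers of games won, as functions on all of \<open>\<nat>\<close>: a number that does not
  belong to a player wins no games.\<close>

definition score_law :: "nat \<Rightarrow> nat set \<Rightarrow> (nat \<Rightarrow> nat) pmf" where
  "score_law k A = map_pmf (\<lambda>rs i. games_won i rs) (knockout p k A)"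

text \<open>The score of every player is one game for winning the first round plus the score in the
  tournament of the first-round winners, where a loser of the first round has score \<open>0\<close>.\<close>

lemma score_law_Suc:
  assumes A: "A \<subseteq> U" "card A = 2 ^ Suc k"
  shows "score_law (Suc k) A = bind_pmf (map_pmf winners (play_round p A))
    (\<lambda>W. map_pmf (\<lambda>g i. of_bool (i \<in> W) + g i) (score_law k W))"
proof -
  have c: "card A = 2 * 2 ^ k" using A by simp
  have "(\<lambda>i. games_won i (r # rs)) = (\<lambda>i. of_bool (i \<in> winners r) + games_won i rs)"
    if "r \<in> set_pmf (play_round p A)" for r rs
    using play_round_support(3)[OF A(1) c] that by (cases r) (auto simp: games_won_def fun_eq_iff)
  then have *: "map_pmf (\<lambda>rs i. games_won i rs) (map_pmf ((#) r) (knockout p k (winners r))) =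
      map_pmf (\<lambda>g i. of_bool (i \<in> winners r) + g i) (score_law k (winners r))"
    if "r \<in> set_pmf (play_round p A)" for r
    using that by (simp add: score_law_def pmf.map_comp comp_def)
  have "knockout p (Suc k) A =
      bind_pmf (play_round p A) (\<lambda>r. map_pmf ((#) r) (knockout p k (winners r)))"
    by (simp add: map_pmf_def)
  then show ?thesis
    unfolding score_law_def[of "Suc k"] by (simp add: map_bind_pmf bind_map_pmf * cong: bind_pmf_cong)
qed

lemma score_law_equivariant:
  assumes "A \<subseteq> U" "\<pi> ` A \<subseteq> U" "card A = 2 ^ k" and \<pi>: "bij \<pi>"
  shows "score_law k (\<pi> ` A) = map_pmf (\<lambda>g. g \<circ> inv \<pi>) (score_law k A)"
  using assms(1-3)
proof (induction k arbitrary: A)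
  case 0
  show ?case by (simp add: score_law_def games_won_def comp_def)
next
  case (Suc k)
  have inj: "inj \<pi>" using \<pi> by (simp add: bij_is_inj)
  have c: "card A = 2 * 2 ^ k" using Suc.prems by simp
  have c': "card (\<pi> ` A) = 2 ^ Suc k" using Suc.prems inj by (simp add: card_image inj_on_subset)
  have img: "i \<in> \<pi> ` W \<longleftrightarrow> inv \<pi> i \<in> W" for i W
    using \<pi> by (metis bij_inv_eq_iff image_iff)
  have "score_law (Suc k) (\<pi> ` A) = bind_pmf (map_pmf winners (play_round p A))
    (\<lambda>W. map_pmf (\<lambda>g i. of_bool (i \<in> \<pi> ` W) + g i) (score_law k (\<pi> ` W)))"
    unfolding score_law_Suc[OF Suc.prems(2) c'] winners_equivariant[OF Suc.prems(1,2) c \<pi>]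
    by (simp only: bind_map_pmf)
  also have "\<dots> = bind_pmf (map_pmf winners (play_round p A))
    (\<lambda>W. map_pmf (\<lambda>g. g \<circ> inv \<pi>) (map_pmf (\<lambda>g i. of_bool (i \<in> W) + g i) (score_law k W)))"
  proof (intro bind_pmf_cong refl)
    fix W assume "W \<in> set_pmf (map_pmf winners (play_round p A))"
    then have "W \<subseteq> A" "card W = 2 ^ k" using play_round_support[OF Suc.prems(1) c] by force+
    moreover from this have "\<pi> ` W \<subseteq> U" using Suc.prems by blast
    ultimately have IH: "score_law k (\<pi> ` W) = map_pmf (\<lambda>g. g \<circ> inv \<pi>) (score_law k W)"
      using Suc.prems by (intro Suc.IH) auto
    show "map_pmf (\<lambda>g i. of_bool (i \<in> \<pi> ` W) + g i) (score_law k (\<pi> ` W)) =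
      map_pmf (\<lambda>g. g \<circ> inv \<pi>) (map_pmf (\<lambda>g i. of_bool (i \<in> W) + g i) (score_law k W))"
      unfolding IH pmf.map_comp by (simp add: comp_def img)
  qed
  also have "\<dots> = map_pmf (\<lambda>g. g \<circ> inv \<pi>) (score_law (Suc k) A)"
    unfolding score_law_Suc[OF Suc.prems(1,3)] by (simp add: map_bind_pmf)
  finally show ?case .
qed

end

text \<open>The multiset of all numbers of games won in a tournament of \<open>k\<close> rounds, which does not depend
  on chance: half of the players lose at once, and the others play \<open>k - 1\<close> further rounds.\<close>

primrec final_scores :: "nat \<Rightarrow> nat multiset" where
  "final_scores 0 = {#0#}"
| "final_scores (Suc k) = replicate_mset (2 ^ k) 0 + image_mset Suc (final_scores k)"

lemma (in fair) score_law_support: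
  assumes "A \<subseteq> U" "card A = 2 ^ k" "g \<in> set_pmf (score_law k A)"
  shows "image_mset g (mset_set A) = final_scores k \<and> (\<forall>i. i \<notin> A \<longrightarrow> g i = 0)"
  using assms
proof (induction k arbitrary: A g)
  case 0
  then obtain i where "A = {i}" by (auto simp: card_1_singleton_iff)
  then show ?case using 0 by (simp add: score_law_def games_won_def)
next
  case (Suc k)
  have c: "card A = 2 * 2 ^ k" using Suc.prems by simp
  have fA: "finite A" using Suc.prems(1) finite_U finite_subset by blast
  from Suc.prems(3)[unfolded score_law_Suc[OF Suc.prems(1,2)]] obtain W g'
    where W: "W \<in> set_pmf (map_pmf winners (play_round p A))" and g': "g' \<in> set_pmf (score_law k W)"
      and g: "g = (\<lambda>i. of_bool (i \<in> W) + g' i)"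
    by auto
  have W: "W \<subseteq> A" "card W = 2 ^ k" using W play_round_support[OF Suc.prems(1) c] by force+
  have IH: "image_mset g' (mset_set W) = final_scores k" "\<And>i. i \<notin> W \<Longrightarrow> g' i = 0"
    using Suc.IH[OF _ W(2) g'] W Suc.prems by auto
  have fW: "finite W" using W fA finite_subset by blast
  have "mset_set A = mset_set (A - W) + mset_set W"
    using mset_set_Union[of "A - W" W] fA fW W(1) Un_absorb2[OF W(1)] by auto
  moreover have "image_mset g (mset_set (A - W)) = image_mset (\<lambda>_. 0) (mset_set (A - W))"
    using IH(2) fA by (intro image_mset_cong) (auto simp: g)
  moreover have "image_mset g (mset_set W) = image_mset (\<lambda>i. Suc (g' i)) (mset_set W)"
    using fW by (intro image_mset_cong) (auto simp: g)
  moreover have "card (A - W) = 2 ^ k" using W c fW by (simp add: card_Diff_subset)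
  ultimately have "image_mset g (mset_set A) = final_scores (Suc k)"
    using IH(1)[symmetric] by (simp add: image_mset_const_eq multiset.map_comp comp_def)
  moreover have "g i = 0" if "i \<notin> A" for i using that W IH(2)[of i] by (auto simp: g)
  ultimately show ?case by blast
qed

section \<open>The score vector is a uniform arrangement of a fixed multiset\<close>

lemma size_final_scores: "size (final_scores k) = 2 ^ k"
  by (induction k) auto

text \<open>The \<open>s\<close>-th smallest final score, counted from \<open>0\<close>. The largest one is repeated beyond \<open>2 ^ l - 1\<close>, so
  that the sequence is increasing on all of \<open>\<nat>\<close>.\<close>

definition score_at :: "nat \<Rightarrow> nat \<Rightarrow> real" where
  "score_at l s = real (sorted_list_of_multiset (final_scores l) ! min s (2 ^ l - 1))"

lemma length_scores: "length (sorted_list_of_multiset (final_scores l)) = 2 ^ l"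
  by (metis mset_sorted_list_of_multiset size_final_scores size_mset)

lemma mono_score_at: "mono (score_at l)"
proof (rule monoI)
  fix s t :: nat assume "s \<le> t"
  then have "min s (2 ^ l - 1) \<le> min t (2 ^ l - 1)" by auto
  moreover have "min t (2 ^ l - 1) < (2::nat) ^ l"
    by (meson diff_less min.strict_coboundedI2 zero_less_numeral zero_less_one zero_less_power)
  ultimately show "score_at l s \<le> score_at l t"
    unfolding score_at_def by (auto intro!: sorted_nth_mono simp: length_scores)
qed

lemma bij_betw_permutations_arrangements:
  assumes "finite U" "\<tau> \<in> arrangements U n"
  shows "bij_betw (\<lambda>\<pi>. restrict (\<tau> \<circ> \<pi>) U) {\<pi>. \<pi> permutes U} (arrangements U n)"
proof (rule bij_betwI[where g = "\<lambda>\<sigma> i. if i \<in> U then inv_into U \<tau> (\<sigma> i) else i"])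
  have \<tau>: "bij_betw \<tau> U {..<n}" using assms by (simp add: arrangements_def)
  show "(\<lambda>\<pi>. restrict (\<tau> \<circ> \<pi>) U) \<in> {\<pi>. \<pi> permutes U} \<rightarrow> arrangements U n"
    using bij_betw_trans[OF permutes_imp_bij \<tau>]
    by (auto simp: arrangements_def comp_def cong: bij_betw_cong)
  show "(\<lambda>\<sigma> i. if i \<in> U then inv_into U \<tau> (\<sigma> i) else i) \<in> arrangements U n \<rightarrow> {\<pi>. \<pi> permutes U}"
    using bij_betw_trans[OF _ bij_betw_inv_into[OF \<tau>]]
    by (auto simp: arrangements_def comp_def intro!: bij_imp_permutes cong: bij_betw_cong)
  show "(\<lambda>i. if i \<in> U then inv_into U \<tau> (restrict (\<tau> \<circ> \<pi>) U i) else i) = \<pi>"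
    if "\<pi> \<in> {\<pi>. \<pi> permutes U}" for \<pi>
    using that \<tau> by (auto simp: fun_eq_iff permutes_in_image permutes_not_in bij_betw_inv_into_left)
  show "restrict (\<tau> \<circ> (\<lambda>i. if i \<in> U then inv_into U \<tau> (\<sigma> i) else i)) U = \<sigma>"
    if "\<sigma> \<in> arrangements U n" for \<sigma>
  proof
    fix i
    have "\<sigma> i \<in> {..<n}" if "i \<in> U"
      using that \<open>\<sigma> \<in> _\<close> by (auto simp: arrangements_def bij_betw_def)
    then show "restrict (\<tau> \<circ> (\<lambda>i. if i \<in> U then inv_into U \<tau> (\<sigma> i) else i)) U i = \<sigma> i"
      using that bij_betw_inv_into_right[OF \<tau>, of "\<sigma> i"] by (auto simp: arrangements_def extensional_def)
  qed
qed

context fair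
begin

lemma finite_score_law:
  assumes "card U = 2 ^ l"
  shows "finite (set_pmf (score_law l U))"
proof (rule finite_subset)
  show "set_pmf (score_law l U) \<subseteq> PiE_dflt U 0 (\<lambda>_. set_mset (final_scores l))"
  proof
    fix g assume "g \<in> set_pmf (score_law l U)"
    then have g: "image_mset g (mset_set U) = final_scores l" "\<And>i. i \<notin> U \<Longrightarrow> g i = 0"
      using score_law_support[of U l g] assms by auto
    have "set_mset (final_scores l) = g ` U"
      using finite_U by (simp add: g(1)[symmetric])
    then show "g \<in> PiE_dflt U 0 (\<lambda>_. set_mset (final_scores l))"
      using g(2) by (auto simp: PiE_dflt_def)
  qed
  show "finite (PiE_dflt U 0 (\<lambda>_. set_mset (final_scores l)))"
    using finite_U by auto
qed

text \<open>Every outcome is an arrangement of the sorted final scores, by the invariance of their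
  multiset.\<close>

lemma score_law_arrangement:
  assumes U: "card U = 2 ^ l" and g: "g \<in> set_pmf (score_law l U)"
  obtains \<tau> where "\<tau> \<in> arrangements U (2 ^ l)" "\<And>i. i \<in> U \<Longrightarrow> real (g i) = score_at l (\<tau> i)"
proof -
  define ys where "ys = sorted_list_of_multiset (final_scores l)"
  have len: "length ys = 2 ^ l" and ys: "mset ys = final_scores l"
    by (simp_all add: ys_def length_scores)
  obtain e where e: "bij_betw e U {..<(2::nat) ^ l}"
    using ex_bij_betw_finite_nat[OF finite_U] U by (metis atLeast0LessThan)
  have "image_mset (\<lambda>i. ys ! e i) (mset_set U) = image_mset ((!) ys) (image_mset e (mset_set U))"
    by (simp add: multiset.map_comp comp_def)
  also have "image_mset e (mset_set U) = mset_set {..<length ys}"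
    using e len by (simp add: bij_betw_def image_mset_mset_set)
  also have "image_mset ((!) ys) \<dots> = mset ys"
    by (metis atLeast0LessThan map_nth mset_map mset_set_upto_eq_mset_upto)
  finally have "image_mset g (mset_set U) = image_mset (\<lambda>i. ys ! e i) (mset_set U)"
    using score_law_support[OF order.refl U g] ys by simp
  from image_mset_eq_implies_permutes[OF finite_U this] obtain \<pi>
    where \<pi>: "\<pi> permutes U" "\<And>i. i \<in> U \<Longrightarrow> g i = ys ! e (\<pi> i)" by metis
  define \<tau> where "\<tau> = restrict (e \<circ> \<pi>) U"
  have b: "bij_betw \<tau> U {..<2 ^ l}"
    using bij_betw_trans[OF permutes_imp_bij[OF \<pi>(1)] e] by (simp add: \<tau>_def cong: bij_betw_cong)
  have "real (g i) = score_at l (\<tau> i)" if "i \<in> U" for i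
  proof -
    have "\<tau> i < 2 ^ l" using b that by (auto simp: bij_betw_def)
    then have "min (\<tau> i) (2 ^ l - 1) = \<tau> i" by linarith
    then show ?thesis using \<pi>(2) that by (simp add: score_at_def ys_def \<tau>_def)
  qed
  moreover have "\<tau> \<in> arrangements U (2 ^ l)" using b by (simp add: arrangements_def \<tau>_def)
  ultimately show thesis by (rule that[rotated])
qed

text \<open>The law of the scores is the law of the sorted final scores along a uniform arrangement. The
  law is invariant under permutations of the players, so \<open>f\<close> may be averaged over all permutations
  of each outcome; that average runs over all arrangements and is the same for every outcome.\<close>

lemma expectation_score_law:
  fixes f :: "(nat \<Rightarrow> real) \<Rightarrow> real"
  assumes U: "card U = 2 ^ l" and f: "\<And>u v. (\<And>i. i \<in> U \<Longrightarrow> u i = v i) \<Longrightarrow> f u = f v"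
  shows "measure_pmf.expectation (score_law l U) (\<lambda>g. f (\<lambda>i. real (g i))) =
    (\<Sum>\<sigma>\<in>arrangements U (2 ^ l). f (\<lambda>i. score_at l (\<sigma> i))) / fact (2 ^ l)"
proof -
  let ?P = "{\<pi>. \<pi> permutes U}" and ?E = "measure_pmf.expectation (score_law l U)"
  let ?s = "\<Sum>\<sigma>\<in>arrangements U (2 ^ l). f (\<lambda>i. score_at l (\<sigma> i))"
  have avg: "(\<Sum>\<pi>\<in>?P. f (\<lambda>i. real (g (\<pi> i)))) = ?s" if "g \<in> set_pmf (score_law l U)" for g
  proof -
    from score_law_arrangement[OF U that] obtain \<tau>
      where \<tau>: "\<tau> \<in> arrangements U (2 ^ l)" "\<And>i. i \<in> U \<Longrightarrow> real (g i) = score_at l (\<tau> i)"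
      by metis
    have "f (\<lambda>i. real (g (\<pi> i))) = f (\<lambda>i. score_at l (restrict (\<tau> \<circ> \<pi>) U i))" if "\<pi> \<in> ?P" for \<pi>
      using that \<tau>(2) by (intro f) (simp add: permutes_in_image)
    then have "(\<Sum>\<pi>\<in>?P. f (\<lambda>i. real (g (\<pi> i)))) =
        (\<Sum>\<pi>\<in>?P. f (\<lambda>i. score_at l (restrict (\<tau> \<circ> \<pi>) U i)))"
      by (rule sum.cong[OF refl])
    also have "\<dots> = ?s"
      by (rule sum.reindex_bij_betw[OF bij_betw_permutations_arrangements[OF finite_U \<tau>(1)]])
    finally show ?thesis .
  qed
  have inv: "?E (\<lambda>g. f (\<lambda>i. real (g (\<pi> i)))) = ?E (\<lambda>g. f (\<lambda>i. real (g i)))" if "\<pi> \<in> ?P" for \<pi>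
  proof -
    have \<pi>: "\<pi> permutes U" using that by simp
    have "score_law l (inv \<pi> ` U) = map_pmf (\<lambda>g. g \<circ> inv (inv \<pi>)) (score_law l U)"
      using \<pi> U by (intro score_law_equivariant) (auto simp: permutes_image[OF permutes_inv] permutes_bij[OF permutes_inv])
    then have "score_law l U = map_pmf (\<lambda>g. g \<circ> \<pi>) (score_law l U)"
      using permutes_image[OF permutes_inv[OF \<pi>]] permutes_inv_inv[OF \<pi>] by simp
    then have "?E (\<lambda>g. f (\<lambda>i. real (g i))) =
        measure_pmf.expectation (map_pmf (\<lambda>g. g \<circ> \<pi>) (score_law l U)) (\<lambda>g. f (\<lambda>i. real (g i)))"
      by simp
    then show ?thesis by simp
  qed
  have "fact (2 ^ l) * ?E (\<lambda>g. f (\<lambda>i. real (g i))) = (\<Sum>\<pi>\<in>?P. ?E (\<lambda>g. f (\<lambda>i. real (g (\<pi> i)))))"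
    using inv card_permutations[OF U finite_U] by simp
  also have "\<dots> = ?E (\<lambda>g. \<Sum>\<pi>\<in>?P. f (\<lambda>i. real (g (\<pi> i))))"
    using finite_score_law[OF U] by (intro Bochner_Integration.integral_sum[symmetric] integrable_measure_pmf_finite)
  also have "\<dots> = ?E (\<lambda>_. ?s)"
    by (intro integral_cong_AE) (auto simp: AE_measure_pmf_iff avg)
  finally show ?thesis by (simp add: field_simps)
qed

end

section \<open>Negative dependence of the scores\<close>

lemma integral_uniform_measure_pmf:
  fixes h :: "'a \<Rightarrow> real"
  assumes "measure (measure_pmf M) E > 0"
  shows "(\<integral>\<omega>. h \<omega> \<partial>uniform_measure (measure_pmf M) E) =
    measure_pmf.expectation M (\<lambda>\<omega>. indicator E \<omega> * h \<omega>) / measure (measure_pmf M) E"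
proof -
  let ?m = "measure (measure_pmf M) E"
  have "uniform_measure (measure_pmf M) E = density (measure_pmf M) (\<lambda>x. ennreal (indicator E x / ?m))"
    unfolding uniform_measure_def using assms
    by (intro arg_cong2[where f = density] refl ext)
       (auto simp: measure_pmf.emeasure_eq_measure divide_ennreal ennreal_indicator[symmetric] simp del: ennreal_indicator)
  then have "(\<integral>\<omega>. h \<omega> \<partial>uniform_measure (measure_pmf M) E) =
      measure_pmf.expectation M (\<lambda>x. (indicator E x / ?m) *\<^sub>R h x)"
    by (simp add: integral_density)
  also have "\<dots> = measure_pmf.expectation M (\<lambda>\<omega>. indicator E \<omega> * h \<omega>) / ?m"
    by simp
  finally show ?thesis .
qed

context fair
begin

lemma expectation_on_cond_event:
  fixes \<phi> :: "(nat \<Rightarrow> real) \<Rightarrow> real"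
  assumes U: "card U = 2 ^ l" and I: "I \<subseteq> U" and J: "J \<subseteq> U"
    and S: "\<And>i rs. S i rs = real (games_won i rs)"
  shows "measure_pmf.expectation (knockout p l U)
      (\<lambda>rs. indicator (cond_event R (measure_pmf (knockout p l U)) S J x) rs * \<phi> (subvec S I rs)) =
    arr_sum (\<lambda>u. \<phi> (restrict u I)) (score_at l) U (2 ^ l) J (\<lambda>j. {s. R (score_at l s) (x j)}) / fact (2 ^ l)"
proof -
  define f where "f u = (if \<forall>j\<in>J. R (u j) (x j) then \<phi> (restrict u I) else 0)" for u
  have f: "f u = f v" if "\<And>i. i \<in> U \<Longrightarrow> u i = v i" for u v
  proof -
    have "restrict u I = restrict v I" using that I by (intro restrict_ext) auto
    moreover have "(\<forall>j\<in>J. R (u j) (x j)) \<longleftrightarrow> (\<forall>j\<in>J. R (v j) (x j))"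
      using that J by (metis subsetD)
    ultimately show ?thesis by (simp add: f_def)
  qed
  have "measure_pmf.expectation (knockout p l U)
      (\<lambda>rs. indicator (cond_event R (measure_pmf (knockout p l U)) S J x) rs * \<phi> (subvec S I rs)) =
    measure_pmf.expectation (knockout p l U) (\<lambda>rs. f (\<lambda>i. real (games_won i rs)))"
    by (intro Bochner_Integration.integral_cong refl)
       (auto simp: f_def cond_event_def subvec_def S indicator_def)
  also have "\<dots> = measure_pmf.expectation (score_law l U) (\<lambda>g. f (\<lambda>i. real (g i)))"
    by (simp add: score_law_def)
  also have "\<dots> = (\<Sum>\<sigma>\<in>arrangements U (2 ^ l). f (\<lambda>i. score_at l (\<sigma> i))) / fact (2 ^ l)"
    by (rule expectation_score_law[OF U f])
  also have "(\<Sum>\<sigma>\<in>arrangements U (2 ^ l). f (\<lambda>i. score_at l (\<sigma> i))) =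
      arr_sum (\<lambda>u. \<phi> (restrict u I)) (score_at l) U (2 ^ l) J (\<lambda>j. {s. R (score_at l s) (x j)})"
    unfolding arr_sum_def f_def using finite_arrangements[OF finite_U]
    by (subst sum.inter_filter[symmetric]) auto
  finally show ?thesis .
qed

text \<open>All three notions of dependence reduce to an inequality between sums over arrangements.\<close>

lemma neg_dependent_knockout:
  assumes U: "U = {1..n}" "n = 2 ^ l"
    and S: "\<And>i rs. S i rs = real (games_won i rs)"
    and ineq: "\<And>I J x x' \<phi>. J \<subseteq> U \<Longrightarrow> I \<subseteq> U - J \<Longrightarrow> increasing_in I \<phi> \<Longrightarrow> (\<And>j. j \<in> J \<Longrightarrow> x j \<le> x' j) \<Longrightarrow>
      arr_sum \<phi> (score_at l) U n J (\<lambda>j. {s. R (score_at l s) (x' j)}) *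
        arr_count U n J (\<lambda>j. {s. R (score_at l s) (x j)})
      \<le> arr_sum \<phi> (score_at l) U n J (\<lambda>j. {s. R (score_at l s) (x j)}) *
        arr_count U n J (\<lambda>j. {s. R (score_at l s) (x' j)})"
  shows "neg_dependent R n (measure_pmf (knockout p l U)) S"
  unfolding neg_dependent_def st_le_def
proof (intro allI impI)
  fix I J and x x' :: "nat \<Rightarrow> real" and \<phi> :: "(nat \<Rightarrow> real) \<Rightarrow> real"
  let ?M = "measure_pmf (knockout p l U)"
  let ?E = "cond_event R ?M S J"
  assume I: "I \<subseteq> {1..n}" and J: "J \<subseteq> {1..n}" and IJ: "I \<inter> J = {}" and le: "\<forall>j\<in>J. x j \<le> x' j"
    and pos: "0 < measure ?M (?E x)" "0 < measure ?M (?E x')"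
    and mono: "mono_on (I \<rightarrow>\<^sub>E UNIV) \<phi>"
  have card: "card U = 2 ^ l" using U by simp
  have IU: "I \<subseteq> U" "J \<subseteq> U" using I J U by auto
  define \<psi> where "\<psi> u = \<phi> (restrict u I)" for u
  have inc: "increasing_in I \<psi>"
    unfolding increasing_in_def \<psi>_def using mono
    by (auto intro!: mono_onD[of _ \<phi>] simp: le_fun_def)
  define A where "A x = arr_sum \<psi> (score_at l) U n J (\<lambda>j. {s. R (score_at l s) (x j)})" for x
  define N where "N x = arr_count U n J (\<lambda>j. {s. R (score_at l s) (x j)})" for x
  have N: "measure ?M (?E x) = N x / fact n" for x
    using expectation_on_cond_event[OF card IU S, of R x "\<lambda>_. 1"]
    by (simp add: N_def arr_count_conv_arr_sum[of _ _ _ _ "score_at l"] U(2))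
  have A: "(\<integral>rs. \<phi> (subvec S I rs) \<partial>uniform_measure ?M (?E x)) = A x / N x"
    if "0 < measure ?M (?E x)" for x
    unfolding integral_uniform_measure_pmf[OF that]
    using expectation_on_cond_event[OF card IU S, of R x \<phi>] N[of x]
    by (simp add: A_def \<psi>_def[abs_def] U(2))
  have "0 < N x" "0 < N x'" using pos by (simp_all add: N zero_less_divide_iff)
  moreover have "A x' * N x \<le> A x * N x'"
    unfolding A_def N_def using IU IJ inc le by (intro ineq) auto
  ultimately show "(\<integral>rs. \<phi> (subvec S I rs) \<partial>uniform_measure ?M (?E x'))
      \<le> (\<integral>rs. \<phi> (subvec S I rs) \<partial>uniform_measure ?M (?E x))"
    unfolding A[OF pos(1)] A[OF pos(2)] by (simp add: divide_simps mult.commute)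
qed

end

theorem theorem3p2:
  fixes l n :: nat and p :: "nat \<Rightarrow> nat \<Rightarrow> real" and S :: "nat \<Rightarrow> round list \<Rightarrow> real"
  assumes "l \<ge> 1" and "n = 2 ^ l"
    and "\<And>i j. i \<in> {1..n} \<Longrightarrow> j \<in> {1..n} \<Longrightarrow> i \<noteq> j \<Longrightarrow> p i j = 1 / 2"
    and "\<And>i rs. S i rs = real (games_won i rs)"
  shows "NRD n (measure_pmf (tournament p l)) S
       \<and> NLTD n (measure_pmf (tournament p l)) S
       \<and> NRTD n (measure_pmf (tournament p l)) S"
proof -
  interpret fair p "{1..n}" using assms(3) by unfold_locales auto
  let ?a = "score_at l"
  have T: "tournament p l = knockout p l {1..n}" by (simp add: tournament_def assms(2))
  have a: "i \<le> j \<Longrightarrow> ?a i \<le> ?a j" for i j using mono_score_at by (rule monoD)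
  have K: "finite {1..n}" "card {1..n} = n" by simp_all
  note dep = neg_dependent_knockout[OF refl assms(2) assms(4)]
  have "neg_dependent (=) n (measure_pmf (knockout p l {1..n})) S"
  proof (rule dep)
    fix I J and x x' :: "nat \<Rightarrow> real" and \<phi>
    assume h: "J \<subseteq> {1..n}" "I \<subseteq> {1..n} - J" "increasing_in I \<phi>" "\<And>j. j \<in> J \<Longrightarrow> x j \<le> x' j"
    have "{s. ?a s = y} = ?a -` {y}" for y by auto
    then show "arr_sum \<phi> ?a {1..n} n J (\<lambda>j. {s. ?a s = x' j}) * arr_count {1..n} n J (\<lambda>j. {s. ?a s = x j})
      \<le> arr_sum \<phi> ?a {1..n} n J (\<lambda>j. {s. ?a s = x j}) * arr_count {1..n} n J (\<lambda>j. {s. ?a s = x' j})"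
      using arr_sum_level_sets[OF K h(1-3) mono_score_at mono_score_at order.refl h(4)] by simp
  qed
  moreover have "neg_dependent (\<le>) n (measure_pmf (knockout p l {1..n})) S"
    by (rule dep, rule arr_sum_down_sets[OF K _ _ _ mono_score_at])
       (auto intro: order.trans[OF a] order.trans)
  moreover have "neg_dependent (>) n (measure_pmf (knockout p l {1..n})) S"
    by (rule dep, rule arr_sum_up_sets[OF K _ _ _ mono_score_at])
       (auto intro: order.strict_trans2[OF _ a] order.strict_trans1)
  ultimately show ?thesis by (simp add: NRD_def NLTD_def NRTD_def T)
qed

end
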